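(* The Kolmogorov quotient of $(\mathbb{Z}[i]\setminus\{0\},\mathcal{T})$, where $\mathcal{T}$ is the coprimality topology, is homeomorphic to the Kolmogorov space $(X,\mathcal{T}_X)$, where $X$ is the set of all finite subsets of the set $\widetilde{\mathcal{P}}$ of associate classes of Gaussian primes and $\mathcal{T}_X$ is the topology on $X$ generated by the sets $\mathcal{O}_F=\{S\in X: S\cap F=\emptyset\}$, $F\in X$.
   Context: $\mathbb{Z}[i]$ is the ring of Gaussian integers, with group of units $\{1,-1,i,-i\}$. Two elements $\alpha,\beta\in\mathbb{Z}[i]\setminus\{0\}$ are associates, written $\alpha\sim\beta$, if $\alpha=u\beta$ for some unit $u$; $\gcd(\alpha,\beta)\sim 1$ means that $\alpha$ and $\beta$ are coprime. For $\alpha\in\mathbb{Z}[i]\setminus\{0\}$ put $\sigma_\alpha=\{\beta\in\mathbb{Z}[i]\setminus\{0\}:\gcd(\alpha,\beta)\sim 1\}$. The coprimality topology $\mathcal{T}$ on $\mathbb{Z}[i]\setminus\{0\}$ is the topology generated by the collection $\{\sigma_\alpha:\alpha\in\mathbb{Z}[i]\setminus\{0\}\}$. Two points of a topological space are topologically indistinguishable if they belong to exactly the same open sets. The Kolmogorov quotient of a topological space $Y$ is the quotient space (with the quotient topology) of $Y$ by the equivalence relation of topological indistinguishability. A Kolmogorov ($T_0$) space is one in which no two distinct points are topologically indistinguishable. *)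

theory Defs
  imports "HOL-Analysis.Analysis" "HOL-Computational_Algebra.Factorial_Ring"
begin

section \<open>The Gaussian integers\<close>

typedef gauss_int = "{z :: complex. Re z \<in> \<int> \<and> Im z \<in> \<int>}"
  morphisms complex_of_gauss_int Abs_gauss_int
  by (rule exI[of _ 0]) simp

setup_lifting type_definition_gauss_int

lift_definition gauss_i :: gauss_int is \<i>
  by simp

instantiation gauss_int :: idom
begin

lift_definition zero_gauss_int :: gauss_int is 0
  by simp

lift_definition one_gauss_int :: gauss_int is 1
  by simp

lift_definition plus_gauss_int :: "gauss_int \<Rightarrow> gauss_int \<Rightarrow> gauss_int" is "(+)"
  by simp

lift_definition minus_gauss_int :: "gauss_int \<Rightarrow> gauss_int \<Rightarrow> gauss_int" is "(-)"
  by simp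

lift_definition uminus_gauss_int :: "gauss_int \<Rightarrow> gauss_int" is uminus
  by simp

lift_definition times_gauss_int :: "gauss_int \<Rightarrow> gauss_int \<Rightarrow> gauss_int" is "(*)"
  by simp

instance
  by standard (transfer; simp add: algebra_simps)+

end

text \<open>
  Division rounds the complex quotient to a nearest Gaussian integer, so that \<open>gauss_int\<close> is a
  Euclidean ring with respect to the norm. The topologies below only depend on the ring structure:
  \<^const>\<open>coprime\<close> and \<^const>\<open>prime_elem\<close> are expressed by divisibility alone.
\<close>

instantiation gauss_int :: euclidean_ring
begin

lift_definition divide_gauss_int :: "gauss_int \<Rightarrow> gauss_int \<Rightarrow> gauss_int" is
  "\<lambda>z w. Complex (of_int (round (Re (z / w)))) (of_int (round (Im (z / w))))"
  by simp

definition modulo_gauss_int :: "gauss_int \<Rightarrow> gauss_int \<Rightarrow> gauss_int" where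
  "modulo_gauss_int a b = a - a div b * b"

lift_definition euclidean_size_gauss_int :: "gauss_int \<Rightarrow> nat" is
  "\<lambda>z. nat \<lfloor>(cmod z)\<^sup>2\<rfloor>" .

lemma of_nat_euclidean_size_gauss_int:
  "real (euclidean_size a) = (cmod (complex_of_gauss_int a))\<^sup>2"
proof transfer
  fix z :: complex
  assume "Re z \<in> \<int> \<and> Im z \<in> \<int>"
  then have "(cmod z)\<^sup>2 \<in> \<int>"
    by (simp add: cmod_power2)
  then obtain k where "(cmod z)\<^sup>2 = of_int k"
    by (elim Ints_cases)
  moreover from this have "k \<ge> 0"
    by (metis of_int_0_le_iff zero_le_power2)
  ultimately show "real (nat \<lfloor>(cmod z)\<^sup>2\<rfloor>) = (cmod z)\<^sup>2"
    by simp
qed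

instance
proof
  fix a b :: gauss_int
  show "a div 0 = 0"
    by transfer (simp add: complex_eq_iff)
  show "a * b div b = a" if "b \<noteq> 0"
    using that by transfer (auto simp: complex_eq_iff[of "Complex _ _"] elim!: Ints_cases)
  show "a div b * b + a mod b = a"
    by (simp add: modulo_gauss_int_def)
  show "euclidean_size (0 :: gauss_int) = 0"
    by transfer simp
  show "euclidean_size a \<le> euclidean_size (a * b)" if "b \<noteq> 0"
  proof -
    have "euclidean_size b \<noteq> 0"
      using that of_nat_euclidean_size_gauss_int[of b] 
      by (metis complex_of_gauss_int_inject norm_eq_zero of_nat_0 power_eq_0_iff 
          zero_gauss_int.rep_eq)
    moreover have "real (euclidean_size (a * b)) = real (euclidean_size a * euclidean_size b)"
      by (simp add: of_nat_euclidean_size_gauss_int times_gauss_int.rep_eq norm_mult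
          power_mult_distrib)
    ultimately show ?thesis
      by (metis One_nat_def Suc_leI bot_nat_0.not_eq_extremum mult.right_neutral mult_le_mono2
          of_nat_eq_iff)
  qed
  show "euclidean_size (a mod b) < euclidean_size b" if "b \<noteq> 0"
  proof -
    define z w where "z = complex_of_gauss_int a" and "w = complex_of_gauss_int b"
    define q where "q = complex_of_gauss_int (a div b)"
    have w: "w \<noteq> 0"
      using that unfolding w_def by (metis complex_of_gauss_int_inject zero_gauss_int.rep_eq)
    have "\<bar>Re (z / w - q)\<bar> \<le> 1 / 2" "\<bar>Im (z / w - q)\<bar> \<le> 1 / 2"
      using of_int_round_abs_le[of "Re (z / w)"] of_int_round_abs_le[of "Im (z / w)"]
      unfolding q_def z_def w_def divide_gauss_int.rep_eq by (auto simp: abs_minus_commute)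
    then have "(Re (z / w - q))\<^sup>2 \<le> (1 / 2)\<^sup>2" "(Im (z / w - q))\<^sup>2 \<le> (1 / 2)\<^sup>2"
      by (metis power2_abs power_mono abs_ge_zero)+
    then have "(cmod (z / w - q))\<^sup>2 \<le> 1 / 2"
      unfolding cmod_power2 by (simp add: power2_eq_square)
    then have "(cmod (z / w - q))\<^sup>2 * (cmod w)\<^sup>2 \<le> 1 / 2 * (cmod w)\<^sup>2"
      by (rule mult_right_mono) simp
    also have "\<dots> < (cmod w)\<^sup>2"
      using w by simp
    also have "(cmod (z / w - q))\<^sup>2 * (cmod w)\<^sup>2 = (cmod ((z / w - q) * w))\<^sup>2"
      by (simp add: norm_mult power_mult_distrib)
    also have "(z / w - q) * w = complex_of_gauss_int (a mod b)"
      using w by (simp add: modulo_gauss_int_def minus_gauss_int.rep_eq times_gauss_int.rep_eq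
          z_def w_def q_def algebra_simps)
    finally show ?thesis
      by (metis of_nat_euclidean_size_gauss_int of_nat_less_iff w_def)
  qed
qed

end

lemma gauss_int_is_unit_iff: "is_unit (u :: gauss_int) \<longleftrightarrow> u \<in> {1, - 1, gauss_i, - gauss_i}"
proof
  assume "is_unit u"
  then obtain v where "1 = u * v" ..
  then have "euclidean_size u * euclidean_size v = 1"
    using of_nat_euclidean_size_gauss_int[of 1]
    by (metis (no_types, lifting) mult_1 norm_mult norm_one of_nat_1 of_nat_eq_iff of_nat_mult
        of_nat_euclidean_size_gauss_int one_gauss_int.rep_eq power_mult_distrib power_one
        times_gauss_int.rep_eq)
  then have "(cmod (complex_of_gauss_int u))\<^sup>2 = 1"
    by (metis nat_mult_eq_1_iff of_nat_1 of_nat_euclidean_size_gauss_int)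
  moreover obtain m n where mn: "Re (complex_of_gauss_int u) = of_int m"
    "Im (complex_of_gauss_int u) = of_int n"
    using complex_of_gauss_int[of u] by (auto elim!: Ints_cases)
  ultimately have "real_of_int (m\<^sup>2 + n\<^sup>2) = of_int 1"
    by (simp add: cmod_power2)
  then have sum: "m\<^sup>2 + n\<^sup>2 = 1"
    by (simp only: of_int_eq_iff)
  then have "m\<^sup>2 \<le> 1" "n\<^sup>2 \<le> 1"
    using zero_le_power2[of m] zero_le_power2[of n] by linarith+
  then have "m \<in> {- 1, 0, 1}" "n \<in> {- 1, 0, 1}"
    by (auto simp: abs_square_le_1)
  with sum have "(m, n) \<in> {(1, 0), (- 1, 0), (0, 1), (0, - 1)}"
    by auto
  then show "u \<in> {1, - 1, gauss_i, - gauss_i}"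
    using mn by (auto simp: complex_of_gauss_int_inject[symmetric] complex_eq_iff
        one_gauss_int.rep_eq uminus_gauss_int.rep_eq gauss_i.rep_eq)
next
  have "gauss_i * (- gauss_i) = 1"
    by transfer simp
  then have "is_unit gauss_i" "is_unit (- gauss_i)"
    by (metis dvdI dvd_triv_right)+
  moreover assume "u \<in> {1, - 1, gauss_i, - gauss_i}"
  ultimately show "is_unit u"
    by auto
qed

definition gauss_associates :: "(gauss_int \<times> gauss_int) set" where
  "gauss_associates = {(\<alpha>, \<beta>). \<alpha> \<noteq> 0 \<and> \<beta> \<noteq> 0 \<and> (\<exists>u. is_unit u \<and> \<alpha> = u * \<beta>)}"

lemma equiv_gauss_associates: "equiv (- {0}) gauss_associates"
proof (rule equivI)
  show "gauss_associates \<subseteq> (- {0}) \<times> (- {0})" "refl_on (- {0}) gauss_associates"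
    by (auto simp: gauss_associates_def refl_on_def intro: exI[of _ 1])
  show "sym gauss_associates"
  proof (rule symI)
    fix a b assume "(a, b) \<in> gauss_associates"
    then obtain u where u: "a \<noteq> 0" "b \<noteq> 0" "is_unit u" "a = u * b"
      by (auto simp: gauss_associates_def)
    then obtain v where "1 = u * v"
      by (elim dvdE)
    then have "is_unit v" "b = v * a"
      unfolding \<open>a = u * b\<close> by (metis dvd_triv_right, metis mult.assoc mult.commute mult_1)
    then show "(b, a) \<in> gauss_associates"
      using u by (auto simp: gauss_associates_def)
  qed
  show "trans gauss_associates"
  proof (rule transI)
    fix a b c assume "(a, b) \<in> gauss_associates" "(b, c) \<in> gauss_associates"
    then obtain u v where "a \<noteq> 0" "c \<noteq> 0" "is_unit u" "is_unit v" "a = (u * v) * c"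
      by (auto simp: gauss_associates_def mult.assoc)
    then show "(a, c) \<in> gauss_associates"
      unfolding gauss_associates_def using unit_prod by blast
  qed
qed

section \<open>The coprimality topology\<close>

definition coprime_set :: "gauss_int \<Rightarrow> gauss_int set" where
  "coprime_set \<alpha> = {\<beta>. \<beta> \<noteq> 0 \<and> coprime \<alpha> \<beta>}"

definition coprimality_topology :: "gauss_int topology" where
  "coprimality_topology = topology_generated_by {coprime_set \<alpha> |\<alpha>. \<alpha> \<noteq> 0}"

text \<open>
  \<^const>\<open>topology_generated_by\<close> takes the union of the generating sets as the underlying space;
  it is the intended one, because the set \<open>\<sigma>\<^sub>1\<close> contains all nonzero elements.
\<close>

lemma topspace_coprimality_topology: "topspace coprimality_topology = - {0}"
proof -
  have "coprime_set 1 = - {0}"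
    by (auto simp: coprime_set_def)
  moreover have "coprime_set \<alpha> \<subseteq> - {0}" for \<alpha>
    by (auto simp: coprime_set_def)
  ultimately show ?thesis
    unfolding coprimality_topology_def topology_generated_by_topspace
    by (intro equalityI Union_least Union_upper) (auto intro!: exI[of _ 1])
qed

section \<open>Quotient topologies and the Kolmogorov quotient\<close>

definition quotient_topology :: "'a topology \<Rightarrow> ('a \<times> 'a) set \<Rightarrow> 'a set topology" where
  "quotient_topology Y r =
     topology (\<lambda>U. U \<subseteq> topspace Y // r \<and> openin Y {x \<in> topspace Y. r `` {x} \<in> U})"

lemma openin_quotient_topology:
  "openin (quotient_topology Y r) U \<longleftrightarrow>
     U \<subseteq> topspace Y // r \<and> openin Y {x \<in> topspace Y. r `` {x} \<in> U}"
proof -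
  have "istopology (\<lambda>U. U \<subseteq> topspace Y // r \<and> openin Y {x \<in> topspace Y. r `` {x} \<in> U})"
    unfolding istopology_def
  proof (intro conjI allI impI)
    fix S T
    assume "S \<subseteq> topspace Y // r \<and> openin Y {x \<in> topspace Y. r `` {x} \<in> S}"
      "T \<subseteq> topspace Y // r \<and> openin Y {x \<in> topspace Y. r `` {x} \<in> T}"
    moreover have "{x \<in> topspace Y. r `` {x} \<in> S \<inter> T} =
        {x \<in> topspace Y. r `` {x} \<in> S} \<inter> {x \<in> topspace Y. r `` {x} \<in> T}"
      by auto
    ultimately show "S \<inter> T \<subseteq> topspace Y // r" "openin Y {x \<in> topspace Y. r `` {x} \<in> S \<inter> T}"
      by auto
  next
    fix \<K>
    assume *: "\<forall>K\<in>\<K>. K \<subseteq> topspace Y // r \<and> openin Y {x \<in> topspace Y. r `` {x} \<in> K}"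
    then show "\<Union>\<K> \<subseteq> topspace Y // r"
      by auto
    have "{x \<in> topspace Y. r `` {x} \<in> \<Union>\<K>} = (\<Union>K\<in>\<K>. {x \<in> topspace Y. r `` {x} \<in> K})"
      by auto
    with * show "openin Y {x \<in> topspace Y. r `` {x} \<in> \<Union>\<K>}"
      by auto
  qed
  then show ?thesis
    by (simp add: quotient_topology_def topology_inverse')
qed

lemma topspace_quotient_topology: "topspace (quotient_topology Y r) = topspace Y // r"
proof -
  have "{x \<in> topspace Y. r `` {x} \<in> topspace Y // r} = topspace Y"
    by (auto simp: quotient_def)
  then have "openin (quotient_topology Y r) (topspace Y // r)"
    by (simp add: openin_quotient_topology)
  then show ?thesis
    by (metis openin_quotient_topology openin_subset openin_topspace subset_antisym)
qed

lemma quotient_map_quotient_topology: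
  "quotient_map Y (quotient_topology Y r) (\<lambda>x. r `` {x})"
  unfolding quotient_map_def topspace_quotient_topology openin_quotient_topology
  by (auto simp: quotient_def)

definition indistinguishable :: "'a topology \<Rightarrow> ('a \<times> 'a) set" where
  "indistinguishable Y = {(x, y). x \<in> topspace Y \<and> y \<in> topspace Y \<and>
     (\<forall>U. openin Y U \<longrightarrow> (x \<in> U \<longleftrightarrow> y \<in> U))}"

lemma equiv_indistinguishable: "equiv (topspace Y) (indistinguishable Y)"
  by (rule equivI) (auto simp: indistinguishable_def refl_on_def sym_def trans_def)

text \<open>
  The library's \<^const>\<open>Kolmogorov_quotient\<close> is a retraction onto a chosen set of representatives;
  here the quotient is the space of equivalence classes.
\<close>

definition Kolmogorov_quotient_space :: "'a topology \<Rightarrow> 'a set topology" where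
  "Kolmogorov_quotient_space Y = quotient_topology Y (indistinguishable Y)"

section \<open>Finite sets of associate classes of Gaussian primes\<close>

definition gauss_prime_classes :: "gauss_int set set" where
  "gauss_prime_classes = {\<pi>. prime_elem \<pi>} // gauss_associates"

definition finite_prime_sets :: "gauss_int set set set" where
  "finite_prime_sets = {S. finite S \<and> S \<subseteq> gauss_prime_classes}"

definition avoiding_set :: "gauss_int set set \<Rightarrow> gauss_int set set set" where
  "avoiding_set F = {S \<in> finite_prime_sets. S \<inter> F = {}}"

definition finite_prime_sets_topology :: "gauss_int set set topology" where
  "finite_prime_sets_topology = topology_generated_by {avoiding_set F |F. F \<in> finite_prime_sets}"

lemma topspace_finite_prime_sets_topology:
  "topspace finite_prime_sets_topology = finite_prime_sets"
proof -
  have "avoiding_set {} = finite_prime_sets" "{} \<in> finite_prime_sets"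
    by (auto simp: avoiding_set_def finite_prime_sets_def)
  moreover have "avoiding_set F \<subseteq> finite_prime_sets" for F
    by (auto simp: avoiding_set_def)
  ultimately show ?thesis
    unfolding finite_prime_sets_topology_def topology_generated_by_topspace by blast
qed

end

theory Submission
  imports Defs
begin

text \<open>
  The homeomorphism is induced by the map that sends a nonzero Gaussian integer \<open>\<alpha>\<close> to its prime
  support, the set of associate classes of primes dividing \<open>\<alpha>\<close>. Being Euclidean, the Gaussian
  integers have finite prime supports, and \<open>\<alpha>\<close>, \<open>\<beta>\<close> are coprime exactly when their supports are
  disjoint. So the preimage of \<open>\<O>\<^sub>F\<close> under the support map is \<open>\<sigma>\<^sub>\<alpha>\<close> for any \<open>\<alpha>\<close> with support \<open>F\<close>.
  Such an \<open>\<alpha>\<close> exists for every finite \<open>F\<close>: multiply representatives of the classes in \<open>F\<close>.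
  Hence the generating sets of the coprimality topology are precisely the preimages of the
  generating sets \<open>\<O>\<^sub>F\<close>, and the coprimality topology is the initial topology of the support map
  (lemma \<open>openin_topology_generated_by_preimages\<close>).

  The target is \<open>T\<^sub>0\<close>, because \<open>\<O>\<^bsub>{P}\<^esub>\<close> tells apart two finite sets of which only one contains \<open>P\<close>.
  A surjection onto a \<open>T\<^sub>0\<close> space for which the source carries the initial topology always
  identifies the Kolmogorov quotient of the source with the target
  (lemma \<open>Kolmogorov_quotient_space_homeomorphic_initial\<close>): its fibres are the classes of
  indistinguishable points, and it is a quotient map.
\<close>

section \<open>Initial topologies and Kolmogorov quotients\<close>

text \<open>
  Preimages commute with finite intersections and arbitrary unions, so generating a topology and
  pulling it back may be interchanged.
\<close>

lemma openin_topology_generated_by_preimages: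
  "openin (topology_generated_by ((\<lambda>B. S \<inter> f -` B) ` \<B>)) U \<longleftrightarrow>
     (\<exists>V. openin (topology_generated_by \<B>) V \<and> U = S \<inter> f -` V)"
proof
  assume "openin (topology_generated_by ((\<lambda>B. S \<inter> f -` B) ` \<B>)) U"
  then have "generate_topology_on ((\<lambda>B. S \<inter> f -` B) ` \<B>) U"
    by (rule openin_topology_generated_by)
  then have "openin (pullback_topology S f (topology_generated_by \<B>)) U"
  proof induction
    case (Basis U)
    then show ?case
      by (auto simp: openin_pullback_topology intro!: topology_generated_by_Basis)
  qed auto
  then show "\<exists>V. openin (topology_generated_by \<B>) V \<and> U = S \<inter> f -` V"
    by (auto simp: openin_pullback_topology)
next
  assume "\<exists>V. openin (topology_generated_by \<B>) V \<and> U = S \<inter> f -` V"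
  then obtain V where V: "generate_topology_on \<B> V" and U: "U = S \<inter> f -` V"
    using openin_topology_generated_by by blast
  from V have "openin (topology_generated_by ((\<lambda>B. S \<inter> f -` B) ` \<B>)) (S \<inter> f -` V)"
  proof induction
    case (Int V W)
    have "S \<inter> f -` (V \<inter> W) = (S \<inter> f -` V) \<inter> (S \<inter> f -` W)"
      by auto
    with openin_Int[OF Int.IH] show ?case
      by simp
  next
    case (UN K)
    have "S \<inter> f -` \<Union>K = (\<Union>V\<in>K. S \<inter> f -` V)"
      by auto
    moreover have "openin (topology_generated_by ((\<lambda>B. S \<inter> f -` B) ` \<B>)) \<dots>"
      using UN.IH by (intro openin_Union) auto
    ultimately show ?case
      by (simp only:)
  qed (auto intro: topology_generated_by_Basis)
  with U show "openin (topology_generated_by ((\<lambda>B. S \<inter> f -` B) ` \<B>)) U"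
    by simp
qed

text \<open>
  Both \<open>f\<close> and the projection to the Kolmogorov quotient are quotient maps on \<open>Y\<close>. They have the same
  fibres, since points with equal images lie in the same preimages, and points with different
  images are separated by the preimage of an open set of the \<open>T\<^sub>0\<close> space \<open>X\<close>. Quotient maps
  with the same fibres have homeomorphic targets.
\<close>

lemma Kolmogorov_quotient_space_homeomorphic_initial:
  assumes surj: "f ` topspace Y = topspace X"
    and initial: "\<And>U. openin Y U \<longleftrightarrow> (\<exists>V. openin X V \<and> U = topspace Y \<inter> f -` V)"
    and T0: "t0_space X"
  shows "Kolmogorov_quotient_space Y homeomorphic_space X"
proof -
  let ?r = "indistinguishable Y"
  have fibres: "?r `` {x} = ?r `` {y} \<longleftrightarrow> f x = f y"
    if x: "x \<in> topspace Y" and y: "y \<in> topspace Y" for x y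
  proof -
    have "f x \<in> topspace X" "f y \<in> topspace X"
      using surj x y by auto
    then have "f x = f y \<longleftrightarrow> (\<forall>V. openin X V \<longrightarrow> (f x \<in> V \<longleftrightarrow> f y \<in> V))"
      using T0 unfolding t0_space_def by metis
    also have "\<dots> \<longleftrightarrow> (x, y) \<in> ?r"
      using x y by (auto simp: indistinguishable_def initial)
    finally show ?thesis
      using eq_equiv_class_iff[OF equiv_indistinguishable x y] by simp
  qed
  have proj: "quotient_map Y (Kolmogorov_quotient_space Y) (\<lambda>x. ?r `` {x})"
    unfolding Kolmogorov_quotient_space_def by (rule quotient_map_quotient_topology)
  have f: "quotient_map Y X f"
    unfolding quotient_map_def
  proof (intro conjI allI impI)
    fix V
    assume V: "V \<subseteq> topspace X"
    let ?U = "{x \<in> topspace Y. f x \<in> V}"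
    show "openin Y ?U \<longleftrightarrow> openin X V"
    proof
      assume "openin Y ?U"
      then obtain W where W: "openin X W" "?U = topspace Y \<inter> f -` W"
        unfolding initial by metis
      \<comment> \<open>By surjectivity, a subset of the target is the image of its preimage.\<close>
      have "V = f ` ?U"
        using V surj by auto
      also have "\<dots> = W"
        unfolding W(2) using openin_subset[OF W(1)] unfolding surj[symmetric] by blast
      finally show "openin X V"
        using W(1) by simp
    next
      assume "openin X V"
      moreover have "?U = topspace Y \<inter> f -` V"
        by auto
      ultimately show "openin Y ?U"
        unfolding initial by metis
    qed
  qed (rule surj)
  obtain g where g: "continuous_map (Kolmogorov_quotient_space Y) X g"
    "\<And>x. x \<in> topspace Y \<Longrightarrow> g (?r `` {x}) = f x"
    using quotient_map_lift_exists[OF proj quotient_imp_continuous_map[OF f]] fibres by metis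
  obtain h where h: "continuous_map X (Kolmogorov_quotient_space Y) h"
    "\<And>x. x \<in> topspace Y \<Longrightarrow> h (f x) = ?r `` {x}"
    using quotient_map_lift_exists[OF f quotient_imp_continuous_map[OF proj]] fibres by metis
  have "homeomorphic_maps (Kolmogorov_quotient_space Y) X g h"
    unfolding homeomorphic_maps_def
  proof (intro conjI ballI)
    fix c
    assume "c \<in> topspace (Kolmogorov_quotient_space Y)"
    then obtain x where "x \<in> topspace Y" "c = ?r `` {x}"
      using quotient_imp_surjective_map[OF proj] by blast
    then show "h (g c) = c"
      using g(2) h(2) by simp
  next
    fix z
    assume "z \<in> topspace X"
    then obtain x where "x \<in> topspace Y" "z = f x"
      using surj by blast
    then show "g (h z) = z"
      using g(2) h(2) by simp
  qed (rule g(1) h(1))+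
  then show ?thesis
    unfolding homeomorphic_space_def by blast
qed

section \<open>Prime divisors in Euclidean rings\<close>

text \<open>
  The Euclidean algorithm on the pair \<open>(c, a)\<close>: if \<open>a * b = c * k\<close>, then \<open>a\<close> divides
  \<open>(c mod a) * k\<close>, so the claim for the next pair \<open>(a, c mod a)\<close> gives \<open>a dvd k\<close>, and cancelling
  \<open>a\<close> gives \<open>c dvd b\<close>.
\<close>

lemma euclidean_coprime_dvd_mult:
  fixes a b c :: "'a :: euclidean_ring"
  assumes "coprime c a" "c dvd a * b"
  shows "c dvd b"
  using assms
proof (induction "euclidean_size a" arbitrary: a b c rule: less_induct)
  case less
  show ?case
  proof (cases "a = 0")
    case True
    with less.prems show ?thesis
      by (simp add: unit_imp_dvd)
  next
    case False
    from less.prems obtain k where k: "a * b = c * k"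
      by (elim dvdE)
    have "(c mod a) * k = a * b - a * ((c div a) * k)"
      using k by (simp add: minus_div_mult_eq_mod[symmetric] algebra_simps)
    then have "a dvd (c mod a) * k"
      by simp
    moreover have "coprime a (c mod a)"
      using False less.prems by (simp add: coprime_commute)
    ultimately have "a dvd k"
      using less.hyps[of "c mod a"] mod_size_less[OF False] by blast
    then obtain m where "k = a * m"
      by (elim dvdE)
    with k False show ?thesis
      by (simp add: mult.left_commute)
  qed
qed

text \<open>An irreducible element that does not divide \<open>a\<close> is coprime to \<open>a\<close>, so Euclid's lemma applies.\<close>

lemma euclidean_irreducible_imp_prime_elem:
  fixes p :: "'a :: euclidean_ring"
  assumes "irreducible p"
  shows "prime_elem p"
proof (rule prime_elemI)
  fix a b
  assume dvd: "p dvd a * b"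
  show "p dvd a \<or> p dvd b"
  proof (cases "p dvd a")
    case False
    have "coprime p a"
    proof (rule coprimeI)
      fix d
      assume "d dvd p" "d dvd a"
      with False show "is_unit d"
        using irreducibleD'[OF assms] dvd_trans by blast
    qed
    with dvd show ?thesis
      using euclidean_coprime_dvd_mult by blast
  qed simp
qed (use assms in \<open>auto simp: irreducible_def\<close>)

lemma euclidean_prime_divisor_exists:
  fixes a :: "'a :: euclidean_ring"
  assumes "a \<noteq> 0" "\<not> is_unit a"
  obtains p where "prime_elem p" "p dvd a"
proof -
  \<comment> \<open>A nonunit divisor of least size is irreducible.\<close>
  obtain p where p: "p dvd a" "\<not> is_unit p"
    and least: "\<And>q. q dvd a \<Longrightarrow> \<not> is_unit q \<Longrightarrow> euclidean_size p \<le> euclidean_size q"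
    using ex_has_least_nat[of "\<lambda>p. p dvd a \<and> \<not> is_unit p" a euclidean_size] assms by auto
  have "p \<noteq> 0"
    using assms p by auto
  have "irreducible p"
  proof (rule irreducibleI)
    fix x y
    assume xy: "p = x * y"
    show "is_unit x \<or> is_unit y"
    proof (rule ccontr)
      assume "\<not> (is_unit x \<or> is_unit y)"
      moreover from this have "euclidean_size y < euclidean_size p"
        using euclidean_size_times_nonunit[of x y] xy \<open>p \<noteq> 0\<close> by auto
      moreover have "y dvd a"
        using xy p by (metis dvd_trans dvd_triv_right)
      ultimately show False
        using least[of y] by auto
    qed
  qed (use p \<open>p \<noteq> 0\<close> in auto)
  with p that show ?thesis
    using euclidean_irreducible_imp_prime_elem by blast
qed

text \<open>Splitting off a prime divisor lowers the Euclidean size, so this can be repeated.\<close>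

lemma euclidean_prime_factor_induct [consumes 1, case_names unit prime_mult]:
  fixes a :: "'a :: euclidean_ring"
  assumes "a \<noteq> 0"
    and unit: "\<And>a. is_unit a \<Longrightarrow> P a"
    and mult: "\<And>p a. prime_elem p \<Longrightarrow> a \<noteq> 0 \<Longrightarrow> P a \<Longrightarrow> P (p * a)"
  shows "P a"
  using \<open>a \<noteq> 0\<close>
proof (induction "euclidean_size a" arbitrary: a rule: less_induct)
  case less
  show ?case
  proof (cases "is_unit a")
    case False
    with less.prems obtain p b where p: "prime_elem p" and a: "a = p * b"
      using euclidean_prime_divisor_exists[of a] by (metis dvdE)
    with less.prems have "b \<noteq> 0" "euclidean_size b < euclidean_size a"
      using euclidean_size_times_nonunit[of p b] prime_elem_not_unit[OF p] by auto
    then show ?thesis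
      using less.hyps[of b] mult[OF p] a by blast
  qed (rule unit)
qed

section \<open>Prime supports\<close>

definition prime_support :: "gauss_int \<Rightarrow> gauss_int set set" where
  "prime_support a = {P \<in> gauss_prime_classes. \<exists>p\<in>P. p dvd a}"

lemma gauss_prime_classesE:
  assumes "P \<in> gauss_prime_classes"
  obtains p where "prime_elem p" "P = gauss_associates `` {p}"
  using assms by (auto simp: gauss_prime_classes_def quotient_def)

text \<open>Associates divide the same elements, so any representative of a class decides membership.\<close>

lemma class_in_prime_support_iff:
  assumes "prime_elem p"
  shows "gauss_associates `` {p} \<in> prime_support a \<longleftrightarrow> p dvd a"
proof
  assume "p dvd a"
  moreover have "p \<in> gauss_associates `` {p}"
    using equiv_class_self[OF equiv_gauss_associates, of p] assms by auto
  moreover have "gauss_associates `` {p} \<in> gauss_prime_classes"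
    using assms by (auto simp: gauss_prime_classes_def quotient_def)
  ultimately show "gauss_associates `` {p} \<in> prime_support a"
    unfolding prime_support_def by blast
next
  assume "gauss_associates `` {p} \<in> prime_support a"
  then obtain q where "(p, q) \<in> gauss_associates" "q dvd a"
    by (auto simp: prime_support_def)
  then show "p dvd a"
    by (auto simp: gauss_associates_def mult_unit_dvd_iff')
qed

lemma prime_support_unit:
  assumes "is_unit u"
  shows "prime_support u = {}"
proof -
  have "P \<notin> prime_support u" if "P \<in> gauss_prime_classes" for P
    using gauss_prime_classesE[OF that] class_in_prime_support_iff assms
    by (metis dvd_trans prime_elem_not_unit)
  then show ?thesis
    by (auto simp: prime_support_def)
qed

lemma prime_support_prime_mult:
  assumes p: "prime_elem p"
  shows "prime_support (p * a) = insert (gauss_associates `` {p}) (prime_support a)"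
    (is "_ = insert ?P _")
proof -
  have P: "?P \<in> gauss_prime_classes"
    using p by (auto simp: gauss_prime_classes_def quotient_def)
  have "Q \<in> prime_support (p * a) \<longleftrightarrow> Q = ?P \<or> Q \<in> prime_support a"
    if "Q \<in> gauss_prime_classes" for Q
    using that
  proof (rule gauss_prime_classesE)
    fix q
    assume q: "prime_elem q" and Q: "Q = gauss_associates `` {q}"
    have "q dvd p \<longleftrightarrow> Q = ?P"
    proof
      assume "q dvd p"
      \<comment> \<open>The cofactor of \<open>q\<close> in \<open>p\<close> is a unit, since \<open>p\<close> is irreducible.\<close>
      then obtain u where u: "p = u * q"
        by (metis dvdE mult.commute)
      then have "is_unit u"
        using p q by (metis irreducibleD prime_elem_imp_irreducible prime_elem_not_unit)
      with u p q have "(p, q) \<in> gauss_associates"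
        by (auto simp: gauss_associates_def)
      then show "Q = ?P"
        using Q equiv_class_eq[OF equiv_gauss_associates] by blast
    next
      assume "Q = ?P"
      then show "q dvd p"
        using class_in_prime_support_iff[OF p, of p] class_in_prime_support_iff[OF q, of p] Q
        by simp
    qed
    then show ?thesis
      using class_in_prime_support_iff[OF q] Q prime_elem_dvd_mult_iff[OF q] by auto
  qed
  moreover have "prime_support b \<subseteq> gauss_prime_classes" for b
    by (auto simp: prime_support_def)
  ultimately show ?thesis
    using P by blast
qed

lemma finite_prime_support:
  assumes "a \<noteq> 0"
  shows "finite (prime_support a)"
  using assms
  by (induction rule: euclidean_prime_factor_induct)
    (auto simp: prime_support_unit prime_support_prime_mult)

lemma prime_support_surj:
  assumes "finite F" "F \<subseteq> gauss_prime_classes"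
  shows "\<exists>a. a \<noteq> 0 \<and> prime_support a = F"
  using assms
proof (induction F rule: finite_induct)
  case empty
  show ?case
    using prime_support_unit[of 1] by (auto intro!: exI[of _ 1])
next
  case (insert P F)
  then obtain a where a: "a \<noteq> 0" "prime_support a = F"
    by auto
  obtain p where p: "prime_elem p" "P = gauss_associates `` {p}"
    using insert.prems gauss_prime_classesE by blast
  have "p * a \<noteq> 0" "prime_support (p * a) = insert P F"
    using a p prime_support_prime_mult by auto
  then show ?case
    by blast
qed

lemma prime_support_image: "prime_support ` (- {0}) = finite_prime_sets"
proof
  show "prime_support ` (- {0}) \<subseteq> finite_prime_sets"
    by (auto simp: finite_prime_sets_def finite_prime_support)
      (auto simp: prime_support_def)
  show "finite_prime_sets \<subseteq> prime_support ` (- {0})"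
  proof
    fix F
    assume "F \<in> finite_prime_sets"
    then obtain a where "a \<noteq> 0" "prime_support a = F"
      using prime_support_surj[of F] unfolding finite_prime_sets_def by auto
    then show "F \<in> prime_support ` (- {0})"
      by auto
  qed
qed

text \<open>
  A common nonunit divisor of \<open>a\<close> and \<open>b\<close> is nonzero because \<open>a\<close> is, so it has a prime divisor, whose
  class lies in both supports.
\<close>

lemma coprime_iff_disjoint_prime_support:
  assumes "a \<noteq> 0"
  shows "coprime a b \<longleftrightarrow> prime_support a \<inter> prime_support b = {}"
proof
  assume coprime: "coprime a b"
  have False if P: "P \<in> prime_support a" "P \<in> prime_support b" for P
  proof -
    obtain p where "prime_elem p" "P = gauss_associates `` {p}"
      using P gauss_prime_classesE unfolding prime_support_def by blast
    with P coprime show False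
      by (metis class_in_prime_support_iff coprime_common_divisor prime_elem_not_unit)
  qed
  then show "prime_support a \<inter> prime_support b = {}"
    by blast
next
  assume disjoint: "prime_support a \<inter> prime_support b = {}"
  show "coprime a b"
  proof (rule coprimeI, rule ccontr)
    fix d
    assume d: "d dvd a" "d dvd b" "\<not> is_unit d"
    then have "d \<noteq> 0"
      using assms by auto
    then obtain p where p: "prime_elem p" "p dvd d"
      using d euclidean_prime_divisor_exists by blast
    then have "gauss_associates `` {p} \<in> prime_support a \<inter> prime_support b"
      using d class_in_prime_support_iff[OF p(1)] dvd_trans by blast
    with disjoint show False
      by blast
  qed
qed

section \<open>The Kolmogorov quotient of the coprimality topology\<close>

lemma coprime_set_eq_preimage:
  assumes "a \<noteq> 0"
  shows "coprime_set a = - {0} \<inter> prime_support -` avoiding_set (prime_support a)"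
proof -
  have "prime_support b \<in> finite_prime_sets" if "b \<noteq> 0" for b
    using that prime_support_image by auto
  then show ?thesis
    by (auto simp: coprime_set_def avoiding_set_def coprime_iff_disjoint_prime_support[OF assms]
        Int_commute)
qed

lemma openin_coprimality_topology_iff:
  "openin coprimality_topology U \<longleftrightarrow>
     (\<exists>V. openin finite_prime_sets_topology V \<and> U = - {0} \<inter> prime_support -` V)"
proof -
  have "{coprime_set a |a. a \<noteq> 0} =
      (\<lambda>a. - {0} \<inter> prime_support -` avoiding_set (prime_support a)) ` (- {0})"
    using coprime_set_eq_preimage by blast
  also have "\<dots> = (\<lambda>F. - {0} \<inter> prime_support -` avoiding_set F) ` finite_prime_sets"
    unfolding prime_support_image[symmetric] image_image ..
  also have "\<dots> = (\<lambda>B. - {0} \<inter> prime_support -` B) ` {avoiding_set F |F. F \<in> finite_prime_sets}"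
    by blast
  finally show ?thesis
    unfolding coprimality_topology_def finite_prime_sets_topology_def
    by (simp only: openin_topology_generated_by_preimages)
qed

lemma t0_space_finite_prime_sets_topology: "t0_space finite_prime_sets_topology"
  unfolding t0_space_def topspace_finite_prime_sets_topology
proof (intro ballI impI)
  fix S T
  assume S: "S \<in> finite_prime_sets" and T: "T \<in> finite_prime_sets" and "S \<noteq> T"
  from \<open>S \<noteq> T\<close> obtain P where P: "P \<in> S \<longleftrightarrow> P \<notin> T"
    by (meson set_eqI)
  have "P \<in> gauss_prime_classes"
    using P S T unfolding finite_prime_sets_def by (cases "P \<in> S") (simp_all add: subset_iff)
  then have "{P} \<in> finite_prime_sets"
    unfolding finite_prime_sets_def by simp
  then have "openin finite_prime_sets_topology (avoiding_set {P})"
    unfolding finite_prime_sets_topology_def by (auto intro!: topology_generated_by_Basis)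
  moreover have "S \<notin> avoiding_set {P} \<longleftrightarrow> T \<in> avoiding_set {P}"
    using P S T by (auto simp: avoiding_set_def)
  ultimately show "\<exists>U. openin finite_prime_sets_topology U \<and> (S \<notin> U \<longleftrightarrow> T \<in> U)"
    by (intro exI conjI)
qed

theorem theorem4p4:
  shows "t0_space finite_prime_sets_topology \<and>
    Kolmogorov_quotient_space coprimality_topology homeomorphic_space finite_prime_sets_topology"
proof
  show "t0_space finite_prime_sets_topology"
    by (rule t0_space_finite_prime_sets_topology)
  then show
    "Kolmogorov_quotient_space coprimality_topology homeomorphic_space finite_prime_sets_topology"
  proof (rule Kolmogorov_quotient_space_homeomorphic_initial[rotated -1])
    show "prime_support ` topspace coprimality_topology = topspace finite_prime_sets_topology"
      by (simp add: topspace_coprimality_topology topspace_finite_prime_sets_topology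
          prime_support_image)
  qed (simp only: openin_coprimality_topology_iff topspace_coprimality_topology)
qed

end
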